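(* Let $G$ be a finite simple connected DP graph whose adjacency matrix has eigenvalues $\lambda_1\ge\lambda_2\ge\dots\ge\lambda_n$. Then for every integer $m>\lambda_1-\lambda_n$, the Cartesian product $G\square K_m$ with the complete graph $K_m$ on $m$ vertices is a DP graph.
   Context: All graphs are finite, simple and connected. $A_i(G)$ is the $0/1$ matrix indexed by $V(G)$ with $(u,v)$-entry $1$ iff $d(u,v)=i$; $A_1(G)$ is the adjacency matrix. $G$ is DP (distance-polynomial) if for every $1\le i\le\operatorname{diam}(G)$ the matrix $A_i(G)$ is a polynomial in $A_1(G)$. The Cartesian product $G\square H$ has vertex set $V(G)\times V(H)$, and $(g_1,h_1)\sim(g_2,h_2)$ iff ($g_1=g_2$ and $h_1\sim h_2$) or ($h_1=h_2$ and $g_1\sim g_2$). *)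

theory Defs
  imports
    "Jordan_Normal_Form.Char_Poly"
    "Graph_Theory.Graph_Theory"
begin

text \<open>
  Finite simple graphs are the symmetric, loopless digraphs without parallel arcs of the
  locale \<^locale>\<open>graph\<close>; an edge is a pair of opposite arcs.  \<^const>\<open>Digraph_Component.connected\<close>
  excludes the null graph.
\<close>

text \<open>Path length is the walk cost for the constant weight 1; the value is \<open>\<infinity>\<close> if there is no path.\<close>

definition graph_dist :: "('a, 'b) pre_digraph \<Rightarrow> 'a \<Rightarrow> 'a \<Rightarrow> ereal" where
  "graph_dist G u v = wf_digraph.\<mu> G (\<lambda>_. 1) u v"

definition graph_diameter :: "('a, 'b) pre_digraph \<Rightarrow> ereal" where
  "graph_diameter G = (SUP u\<in>verts G. SUP v\<in>verts G. graph_dist G u v)"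

text \<open>
  Matrices have natural numbers as indices, so a matrix indexed by the vertices is taken with respect
  to a listing of them; another listing conjugates it by a permutation matrix.
\<close>

definition vertex_listing :: "('a, 'b) pre_digraph \<Rightarrow> 'a list \<Rightarrow> bool" where
  "vertex_listing G vs \<longleftrightarrow> distinct vs \<and> set vs = verts G"

definition dist_mat :: "('a, 'b) pre_digraph \<Rightarrow> 'a list \<Rightarrow> nat \<Rightarrow> real mat" where
  "dist_mat G vs i =
    mat (length vs) (length vs) (\<lambda>(r, c). if graph_dist G (vs ! r) (vs ! c) = ereal (real i) then 1 else 0)"

definition adjacency_mat :: "('a, 'b) pre_digraph \<Rightarrow> 'a list \<Rightarrow> real mat" where
  "adjacency_mat G vs =
    mat (length vs) (length vs) (\<lambda>(r, c). if vs ! r \<rightarrow>\<^bsub>G\<^esub> vs ! c then 1 else 0)"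

definition poly_mat :: "'a::comm_ring_1 poly \<Rightarrow> 'a mat \<Rightarrow> 'a mat" where
  "poly_mat p A =
    mat (dim_row A) (dim_row A) (\<lambda>(r, c). \<Sum>k\<le>degree p. coeff p k * (A ^\<^sub>m k) $$ (r, c))"

definition dp_graph :: "('a, 'b) pre_digraph \<Rightarrow> bool" where
  "dp_graph G \<longleftrightarrow> graph G \<and> Digraph_Component.connected G \<and>
    (\<forall>vs. vertex_listing G vs \<longrightarrow>
      (\<forall>i::nat. 1 \<le> i \<and> ereal (real i) \<le> graph_diameter G \<longrightarrow>
        (\<exists>p :: real poly. dist_mat G vs i = poly_mat p (adjacency_mat G vs))))"

definition cartesian_product ::
  "('a, 'b) pre_digraph \<Rightarrow> ('c, 'd) pre_digraph \<Rightarrow> ('a \<times> 'c, ('a \<times> 'c) \<times> ('a \<times> 'c)) pre_digraph" where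
  "cartesian_product G H =
    \<lparr> verts = verts G \<times> verts H,
      arcs = {((g1, h1), (g2, h2)) | g1 h1 g2 h2.
        g1 \<in> verts G \<and> h1 \<in> verts H \<and> g2 \<in> verts G \<and> h2 \<in> verts H \<and>
        (g1 = g2 \<and> h1 \<rightarrow>\<^bsub>H\<^esub> h2 \<or> h1 = h2 \<and> g1 \<rightarrow>\<^bsub>G\<^esub> g2)},
      tail = fst, head = snd \<rparr>"

lemma graph_dist_eq_1_iff:
  assumes "graph G"
  shows "graph_dist G u v = 1 \<longleftrightarrow> u \<rightarrow>\<^bsub>G\<^esub> v"
proof -
  interpret graph G by fact
  have cost: "awalk_cost (\<lambda>_. 1) p = real (length p)" for p :: "'b list"
    by (induct p) auto
  have d: "graph_dist G u v = (INF p\<in>{p. awalk u p v}. ereal (real (length p)))"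
    unfolding graph_dist_def \<mu>_def cost ..
  show ?thesis
  proof
    assume 1: "graph_dist G u v = 1"
    then have "(INF p\<in>{p. awalk u p v}. ereal (real (length p))) < ereal 2"
      unfolding d by simp
    then obtain p where p: "awalk u p v" "length p < 2"
      unfolding INF_less_iff by auto
    have "u \<noteq> v"
    proof
      assume "u = v"
      then have "awalk u [] v" using p(1) by (auto simp: awalk_Nil_iff)
      then have "graph_dist G u v \<le> ereal (real (length ([] :: 'b list)))"
        unfolding d by (intro INF_lower) simp
      with 1 show False by simp
    qed
    with p obtain e where "p = [e]"
      by (cases p) (auto simp: awalk_Nil_iff)
    with p(1) show "u \<rightarrow>\<^bsub>G\<^esub> v"
      by (auto simp: awalk_Cons_iff awalk_Nil_iff arcs_ends_conv)
  next
    assume "u \<rightarrow>\<^bsub>G\<^esub> v"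
    then obtain e where e: "e \<in> arcs G" "tail G e = u" "head G e = v" by auto
    then have "u \<noteq> v" using no_loops[OF e(1)] by simp
    have "awalk u [e] v" using e by (auto simp: awalk_Cons_iff awalk_Nil_iff)
    then have "graph_dist G u v \<le> ereal (real (length [e]))"
      unfolding d by (intro INF_lower) simp
    moreover have "1 \<le> graph_dist G u v"
      unfolding d
    proof (rule INF_greatest)
      fix p assume "p \<in> {p. awalk u p v}"
      with \<open>u \<noteq> v\<close> have "p \<noteq> []" by (auto simp: awalk_Nil_iff)
      then show "1 \<le> ereal (real (length p))" by (cases p) auto
    qed
    ultimately show "graph_dist G u v = 1" by (simp add: one_ereal_def)
  qed
qed

lemma dist_mat_1: "graph G \<Longrightarrow> dist_mat G vs 1 = adjacency_mat G vs"
  by (simp add: dist_mat_def adjacency_mat_def one_ereal_def[symmetric] graph_dist_eq_1_iff)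

end

theory Submission
  imports Defs "HOL-Computational_Algebra.Field_as_Ring"
begin

text \<open>
  Let \<open>A\<close> be the adjacency matrix of \<open>G\<close> and \<open>A\<^sub>i\<close> its distance matrices.  In \<open>G \<box> K\<^sub>m\<close> the distance
  from \<open>(u, x)\<close> to \<open>(v, y)\<close> is \<open>d(u, v) + [x \<noteq> y]\<close> (\<open>graph_dist_cartesian_product_complete\<close>), so
  for \<open>i \<ge> 1\<close> its \<open>i\<close>-th distance matrix is \<open>A\<^sub>i \<otimes> I + A\<^bsub>i-1\<^esub> \<otimes> (J - I)\<close>.  As \<open>G\<close> is
  distance-polynomial, this is \<open>q(A) \<otimes> I + r(A) \<otimes> J\<close> for some polynomials \<open>q\<close> and \<open>r\<close>.

  The adjacency matrix of the product is \<open>C - I\<close> with \<open>C = A \<otimes> I + I \<otimes> J\<close>.  Since \<open>J^2 = m J\<close>, each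
  polynomial \<open>f\<close> satisfies \<open>f(C) = f(A) \<otimes> I + ((f(A + m I) - f(A)) / m) \<otimes> J\<close>
  (\<open>poly_mat_kron_IJ\<close>).  Hence an \<open>f\<close> with \<open>f(A) = q(A)\<close> and \<open>f(A + m I) = q(A) + m r(A)\<close> suffices.
  The characteristic polynomial \<open>P(X)\<close> annihilates \<open>A\<close> by Cayley-Hamilton, and \<open>P(X - m)\<close>
  annihilates \<open>A + m I\<close>.  The bound \<open>m > \<lambda>\<^sub>1 - \<lambda>\<^sub>n\<close> excludes \<open>\<lambda>\<^sub>i = \<lambda>\<^sub>j + m\<close>, so these two
  polynomials are coprime and the Chinese remainder theorem provides \<open>f\<close>
  (\<open>kron_IJ_in_polynomials\<close>).
\<close>

section \<open>Polynomials in a matrix\<close>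

lemma poly_mat_carrier [simp]: "A \<in> carrier_mat n n \<Longrightarrow> poly_mat p A \<in> carrier_mat n n"
  by (simp add: poly_mat_def)

lemma dim_poly_mat [simp]:
  "dim_row (poly_mat p A) = dim_row A" "dim_col (poly_mat p A) = dim_row A"
  by (simp_all add: poly_mat_def)

lemma poly_mat_index:
  assumes "A \<in> carrier_mat n n" "r < n" "c < n" "degree p \<le> N"
  shows "poly_mat p A $$ (r, c) = (\<Sum>k\<le>N. coeff p k * (A ^\<^sub>m k) $$ (r, c))"
proof -
  have "(\<Sum>k\<le>degree p. coeff p k * (A ^\<^sub>m k) $$ (r, c)) = (\<Sum>k\<le>N. coeff p k * (A ^\<^sub>m k) $$ (r, c))"
    using assms(4) by (intro sum.mono_neutral_left) (auto simp: coeff_eq_0)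
  then show ?thesis
    using assms by (simp add: poly_mat_def)
qed

lemma poly_mat_pCons:
  assumes A: "A \<in> carrier_mat n n"
  shows "poly_mat (pCons a p) A = a \<cdot>\<^sub>m 1\<^sub>m n + poly_mat p A * A"
proof (rule eq_matI)
  fix r c assume "r < dim_row (a \<cdot>\<^sub>m 1\<^sub>m n + poly_mat p A * A)" "c < dim_col (a \<cdot>\<^sub>m 1\<^sub>m n + poly_mat p A * A)"
  then have rc: "r < n" "c < n" using A by auto
  have "poly_mat (pCons a p) A $$ (r, c) =
      (\<Sum>k\<le>Suc (degree p). coeff (pCons a p) k * (A ^\<^sub>m k) $$ (r, c))"
    by (rule poly_mat_index[OF A rc]) (simp add: degree_pCons_le)
  also have "\<dots> = a * 1\<^sub>m n $$ (r, c) + (\<Sum>k\<le>degree p. coeff p k * (A ^\<^sub>m k * A) $$ (r, c))"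
    using A by (simp add: sum.atMost_Suc_shift del: sum.atMost_Suc)
  also have "(\<Sum>k\<le>degree p. coeff p k * (A ^\<^sub>m k * A) $$ (r, c)) =
      (\<Sum>k\<le>degree p. \<Sum>s<n. coeff p k * ((A ^\<^sub>m k) $$ (r, s) * A $$ (s, c)))"
    using A rc by (simp add: scalar_prod_def sum_distrib_left atLeast0LessThan)
  also have "\<dots> = (\<Sum>s<n. poly_mat p A $$ (r, s) * A $$ (s, c))"
    using A rc by (subst sum.swap)
      (simp add: poly_mat_index[OF A _ _ order_refl] sum_distrib_right mult.assoc)
  also have "\<dots> = (poly_mat p A * A) $$ (r, c)"
    using A rc by (simp add: scalar_prod_def atLeast0LessThan)
  finally show "poly_mat (pCons a p) A $$ (r, c) = (a \<cdot>\<^sub>m 1\<^sub>m n + poly_mat p A * A) $$ (r, c)"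
    using A rc by simp
qed (use A poly_mat_carrier[OF A] in auto)

lemma poly_mat_0 [simp]: "poly_mat 0 A = 0\<^sub>m (dim_row A) (dim_row A)"
  by (auto simp: poly_mat_def)

lemma poly_mat_const:
  "A \<in> carrier_mat n n \<Longrightarrow> poly_mat [:a:] A = a \<cdot>\<^sub>m 1\<^sub>m n"
  by (subst poly_mat_pCons) auto

lemma poly_mat_1: "A \<in> carrier_mat n n \<Longrightarrow> poly_mat 1 A = 1\<^sub>m n"
  using poly_mat_const[of A n 1] by (auto simp: one_pCons)

lemma poly_mat_add:
  assumes A: "A \<in> carrier_mat n n"
  shows "poly_mat (p + q) A = poly_mat p A + poly_mat q A"
proof -
  \<comment> \<open>Beyond all degrees that occur, so that the last term \<open>T (Suc N)\<close> of the telescope vanishes.\<close>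
  define N where "N = max (degree p) (degree q)"
  have "degree (p + q) \<le> N" "degree p \<le> N" "degree q \<le> N"
    by (auto simp: N_def degree_add_le_max)
  then show ?thesis
    using A by (intro eq_matI) (auto simp: poly_mat_index[OF A] sum.distrib ring_distribs)
qed

lemma poly_mat_smult:
  assumes A: "A \<in> carrier_mat n n"
  shows "poly_mat (Polynomial.smult a p) A = a \<cdot>\<^sub>m poly_mat p A"
  using A by (intro eq_matI)
    (auto simp: poly_mat_index[OF A, where N = "degree p"] degree_smult_le sum_distrib_left mult.assoc)

lemma poly_mat_diff:
  assumes A: "A \<in> carrier_mat n n"
  shows "poly_mat (p - q) A = poly_mat p A - poly_mat q A"
  using A by (intro eq_matI)
    (auto simp: poly_mat_index[OF A, where N = "max (degree p) (degree q)"] degree_diff_le_max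
      sum_subtractf ring_distribs)

lemma poly_mat_mult:
  assumes A: "A \<in> carrier_mat n n"
  shows "poly_mat (p * q) A = poly_mat p A * poly_mat q A"
proof (induction q)
  case 0
  then show ?case
    using A right_mult_zero_mat[OF poly_mat_carrier[OF A, of p]] by simp
next
  case (pCons a q)
  have P: "poly_mat p A \<in> carrier_mat n n" and Q: "poly_mat q A \<in> carrier_mat n n"
    using A by auto
  have "poly_mat (p * pCons a q) A = a \<cdot>\<^sub>m poly_mat p A + (0 \<cdot>\<^sub>m 1\<^sub>m n + (poly_mat p A * poly_mat q A) * A)"
    by (simp add: poly_mat_add[OF A] poly_mat_smult[OF A] poly_mat_pCons[OF A] pCons)
  also have "0 \<cdot>\<^sub>m 1\<^sub>m n + (poly_mat p A * poly_mat q A) * A = poly_mat p A * (poly_mat q A * A)"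
    unfolding assoc_mult_mat[OF P Q A] using A by (intro eq_matI) auto
  also have "a \<cdot>\<^sub>m poly_mat p A + poly_mat p A * (poly_mat q A * A) =
      poly_mat p A * (a \<cdot>\<^sub>m 1\<^sub>m n + poly_mat q A * A)"
    using mult_add_distrib_mat[OF P, of "a \<cdot>\<^sub>m 1\<^sub>m n" n "poly_mat q A * A"]
      mult_smult_distrib[OF P one_carrier_mat, of a] right_mult_one_mat[OF P] A Q by auto
  finally show ?case by (simp add: poly_mat_pCons[OF A])
qed

lemma poly_mat_pcompose:
  assumes A: "A \<in> carrier_mat n n"
  shows "poly_mat (pcompose p q) A = poly_mat p (poly_mat q A)"
proof (induction p)
  case 0
  then show ?case using A by simp
next
  case (pCons a p)
  then show ?case
    by (simp add: pcompose_pCons poly_mat_add[OF A] poly_mat_const[OF A] mult.commute[of q]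
        poly_mat_mult[OF A] poly_mat_pCons[OF poly_mat_carrier[OF A]])
qed

text \<open>
  The Cayley-Hamilton theorem.  Write \<open>D = X I - A\<close> and \<open>Y = adj D\<close>, so \<open>D Y = det D \<cdot> I\<close> over the
  polynomial ring.  If \<open>Y = (\<Sum>k. X^k Y\<^sub>k)\<close>, then the coefficient of \<open>X^k\<close> in \<open>D Y\<close> is
  \<open>Y\<^bsub>k-1\<^esub> - A Y\<^sub>k\<close>; multiplying it by \<open>A^k\<close> from the left and summing over \<open>k\<close> telescopes to \<open>0\<close>,
  while on the other side the sum is the characteristic polynomial evaluated at \<open>A\<close>.
\<close>

lemma cayley_hamilton:
  fixes A :: "'a :: comm_ring_1 mat"
  assumes A: "A \<in> carrier_mat n n"
  shows "poly_mat (char_poly A) A = 0\<^sub>m n n"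
proof (rule eq_matI)
  fix r c assume "r < dim_row (0\<^sub>m n n :: 'a mat)" "c < dim_col (0\<^sub>m n n :: 'a mat)"
  then have rc: "r < n" "c < n" by auto
  define D where "D = char_poly_matrix A"
  define Y where "Y = adj_mat D"
  have D: "D \<in> carrier_mat n n" using A by (simp add: D_def)
  have Y: "Y \<in> carrier_mat n n" and DY: "D * Y = char_poly A \<cdot>\<^sub>m 1\<^sub>m n"
    using adj_mat[OF D] by (simp_all add: Y_def D_def char_poly_def)
  \<comment> \<open>Beyond all degrees that occur, so that the last term \<open>T (Suc N)\<close> of the telescope vanishes.\<close>
  define N where "N = Suc (Max (insert (degree (char_poly A)) ((\<lambda>s. degree (Y $$ (s, c))) ` {..<n})))"
  have Np: "degree (char_poly A) \<le> N" by (simp add: N_def le_SucI)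
  have NY: "degree (Y $$ (s, c)) < N" if "s < n" for s
    unfolding N_def less_Suc_eq_le using that by (intro Max_ge) auto
  \<comment> \<open>\<open>T k\<close> is the entry of \<open>A^k Y\<^bsub>k-1\<^esub>\<close>; the factor \<open>X\<close> in \<^const>\<open>pCons\<close> makes \<open>T 0\<close> vanish.\<close>
  define T where "T k = (\<Sum>s<n. (A ^\<^sub>m k) $$ (r, s) * coeff (pCons 0 (Y $$ (s, c))) k)" for k
  have DYs: "(if s = c then coeff (char_poly A) k else 0) =
      coeff (pCons 0 (Y $$ (s, c))) k - (\<Sum>t<n. A $$ (s, t) * coeff (Y $$ (t, c)) k)"
    if s: "s < n" for s k
  proof -
    have "(if s = c then char_poly A else 0) = (D * Y) $$ (s, c)"
      unfolding DY using s rc by simp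
    also have "\<dots> = (\<Sum>t<n. D $$ (s, t) * Y $$ (t, c))"
      using D Y s rc by (simp add: scalar_prod_def atLeast0LessThan)
    also have "\<dots> = (\<Sum>t<n. (if t = s then pCons 0 (Y $$ (s, c)) else 0) - Polynomial.smult (A $$ (s, t)) (Y $$ (t, c)))"
      using A s by (intro sum.cong) (auto simp: D_def char_poly_matrix_def algebra_simps)
    also have "\<dots> = pCons 0 (Y $$ (s, c)) - (\<Sum>t<n. Polynomial.smult (A $$ (s, t)) (Y $$ (t, c)))"
      using s by (simp add: sum_subtractf)
    finally have "coeff (if s = c then char_poly A else 0) k = coeff \<dots> k" by simp
    then show ?thesis by (simp add: coeff_sum if_distrib[of "\<lambda>p. coeff p k"] cong: if_cong)
  qed
  have step: "coeff (char_poly A) k * (A ^\<^sub>m k) $$ (r, c) = T k - T (Suc k)" for k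
  proof -
    have "coeff (char_poly A) k * (A ^\<^sub>m k) $$ (r, c) =
        (\<Sum>s<n. (A ^\<^sub>m k) $$ (r, s) * (if s = c then coeff (char_poly A) k else 0))"
      using rc by (simp add: if_distrib[of "\<lambda>x. _ * x"] mult.commute cong: if_cong)
    also have "\<dots> = (\<Sum>s<n. (A ^\<^sub>m k) $$ (r, s) *
        (coeff (pCons 0 (Y $$ (s, c))) k - (\<Sum>t<n. A $$ (s, t) * coeff (Y $$ (t, c)) k)))"
      by (intro sum.cong refl) (simp only: DYs lessThan_iff)
    also have "\<dots> = T k - (\<Sum>s<n. \<Sum>t<n. (A ^\<^sub>m k) $$ (r, s) * A $$ (s, t) * coeff (Y $$ (t, c)) k)"
      by (simp add: T_def right_diff_distrib sum_subtractf sum_distrib_left mult.assoc)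
    also have "(\<Sum>s<n. \<Sum>t<n. (A ^\<^sub>m k) $$ (r, s) * A $$ (s, t) * coeff (Y $$ (t, c)) k) = T (Suc k)"
      using A rc by (subst sum.swap)
        (simp add: T_def scalar_prod_def atLeast0LessThan sum_distrib_right)
    finally show ?thesis .
  qed
  have "poly_mat (char_poly A) A $$ (r, c) = (\<Sum>k\<le>N. T k - T (Suc k))"
    by (simp add: poly_mat_index[OF A rc Np] step)
  also have "\<dots> = T 0 - T (Suc N)" by (rule sum_telescope)
  also have "T 0 = 0" by (simp add: T_def)
  also have "T (Suc N) = 
     (\<Sum>s<n. (A ^\<^sub>m Suc N) $$ (r, s) * coeff (Y $$ (s, c)) N)" by (simp add: T_def)
  also have "\<dots> = 0" using NY by (intro sum.neutral) (simp add: coeff_eq_0)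
  finally show "poly_mat (char_poly A) A $$ (r, c) = 0\<^sub>m n n $$ (r, c)" using rc by simp
qed (use A in auto)

section \<open>Distances in a product with a complete graph\<close>

lemma (in wf_digraph) ex_awalk_iff_relpow:
  assumes "u \<in> verts G"
  shows "(\<exists>p. awalk u p v \<and> length p = k) \<longleftrightarrow> (u, v) \<in> arcs_ends G ^^ k"
  using assms
proof (induction k arbitrary: u)
  case 0
  then show ?case by (auto simp: awalk_Nil_iff)
next
  case (Suc k)
  have "(\<exists>p. awalk u p v \<and> length p = Suc k) \<longleftrightarrow>
      (\<exists>e p. e \<in> arcs G \<and> tail G e = u \<and> awalk (head G e) p v \<and> length p = k)"
    unfolding length_Suc_conv by (metis awalk_Cons_iff)
  also have "\<dots> \<longleftrightarrow> (\<exists>e. e \<in> arcs G \<and> tail G e = u \<and> (head G e, v) \<in> arcs_ends G ^^ k)"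
    using Suc.IH by (metis head_in_verts)
  also have "\<dots> \<longleftrightarrow> (u, v) \<in> arcs_ends G ^^ Suc k"
  proof -
    have "arcs_ends G ^^ Suc k = arcs_ends G O arcs_ends G ^^ k"
      by (simp add: relpow_commute)
    moreover have "tail G e \<rightarrow> head G e" if "e \<in> arcs G" for e
      using that by (intro dominatesI[of e]) (simp_all add: arc_to_ends_def)
    ultimately show ?thesis by (auto simp del: relpow.simps)
  qed
  finally show ?case .
qed

text \<open>
  Distances are infima over arc lists; relational powers of the adjacency relation express them
  without mentioning arcs, whose types differ between a graph and a product built from it.
\<close>

lemma (in wf_digraph) graph_dist_eq_iff:
  assumes u: "u \<in> verts G"
  shows "graph_dist G u v = ereal (real i) \<longleftrightarrow>
    (u, v) \<in> arcs_ends G ^^ i \<and> (\<forall>k<i. (u, v) \<notin> arcs_ends G ^^ k)"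
proof -
  have cost: "awalk_cost (\<lambda>_. 1) p = real (length p)" for p :: "'b list"
    by (induct p) auto
  have d: "graph_dist G u v = (INF p\<in>{p. awalk u p v}. ereal (real (length p)))"
    unfolding graph_dist_def \<mu>_def cost ..
  have less: "graph_dist G u v < ereal (real j) \<longleftrightarrow> (\<exists>k<j. (u, v) \<in> arcs_ends G ^^ k)" for j
    unfolding d INF_less_iff by (auto simp: ex_awalk_iff_relpow[OF u, symmetric])
  have le: "graph_dist G u v \<le> ereal (real j) \<longleftrightarrow> (\<exists>k\<le>j. (u, v) \<in> arcs_ends G ^^ k)" for j
  proof
    assume "graph_dist G u v \<le> ereal (real j)"
    also have "\<dots> < ereal (real (Suc j))" by simp
    finally show "\<exists>k\<le>j. (u, v) \<in> arcs_ends G ^^ k" unfolding less by (auto simp: less_Suc_eq_le)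
  next
    assume "\<exists>k\<le>j. (u, v) \<in> arcs_ends G ^^ k"
    then obtain p where "awalk u p v" "length p \<le> j"
      unfolding ex_awalk_iff_relpow[OF u, symmetric] by auto
    then show "graph_dist G u v \<le> ereal (real j)"
      unfolding d by (intro INF_lower2[of p]) auto
  qed
  have "graph_dist G u v = ereal (real i) \<longleftrightarrow>
      graph_dist G u v \<le> ereal (real i) \<and> \<not> graph_dist G u v < ereal (real i)"
    by auto
  then show ?thesis unfolding less le by (auto simp: order_le_less)
qed

lemma cartesian_product_dominates:
  "(g1, h1) \<rightarrow>\<^bsub>cartesian_product G H\<^esub> (g2, h2) \<longleftrightarrow>
    g1 \<in> verts G \<and> h1 \<in> verts H \<and> g2 \<in> verts G \<and> h2 \<in> verts H \<and>
    (g1 = g2 \<and> h1 \<rightarrow>\<^bsub>H\<^esub> h2 \<or> h1 = h2 \<and> g1 \<rightarrow>\<^bsub>G\<^esub> g2)"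
  unfolding arcs_ends_conv[of "cartesian_product G H"]
  by (force simp: cartesian_product_def)

lemma verts_cartesian_product [simp]:
  "verts (cartesian_product G H) = verts G \<times> verts H"
  by (simp add: cartesian_product_def)

lemma graph_cartesian_product:
  assumes "graph G" "graph H"
  shows "graph (cartesian_product G H)"
proof -
  interpret G: graph G by fact
  interpret H: graph H by fact
  let ?P = "cartesian_product G H"
  have sub: "arcs ?P \<subseteq> (verts G \<times> verts H) \<times> (verts G \<times> verts H)"
    and ends: "tail ?P = fst" "head ?P = snd"
    by (auto simp: cartesian_product_def)
  interpret wf_digraph ?P
    using sub by unfold_locales (auto simp: ends)
  show ?thesis
  proof
    show "finite (verts ?P)" by simp
    show "finite (arcs ?P)" by (rule finite_subset[OF sub]) simp
    show "tail ?P e \<noteq> head ?P e" if "e \<in> arcs ?P" for e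
      using that G.adj_not_same H.adj_not_same by (auto simp: cartesian_product_def)
    show "e1 = e2" if "arc_to_ends ?P e1 = arc_to_ends ?P e2" for e1 e2
      using that by (simp add: arc_to_ends_def ends prod_eq_iff)
    show "symmetric ?P"
      unfolding symmetric_def sym_def
      by (auto simp: cartesian_product_dominates dest: G.graph_symmetric H.graph_symmetric)
  qed
qed

lemma (in wf_digraph) relpow_cartesian_product_lift:
  assumes "(u, v) \<in> arcs_ends G ^^ j" "u \<in> verts G" "x \<in> verts H"
  shows "((u, x), (v, x)) \<in> arcs_ends (cartesian_product G H) ^^ j"
  using assms
proof (induction j arbitrary: v)
  case (Suc j)
  then obtain w where "(u, w) \<in> arcs_ends G ^^ j" "w \<rightarrow>\<^bsub>G\<^esub> v" by auto
  with Suc show ?case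
    by (auto simp: cartesian_product_dominates dest: adj_in_verts intro!: relcompI)
qed simp

text \<open>
  Deleting the moves in the second factor turns a walk of the product into a walk of \<^term>\<open>G\<close>, and
  it deletes at least one step if the second coordinate changes.
\<close>

lemma relpow_cartesian_product_project:
  assumes "((u, x), (v, y)) \<in> arcs_ends (cartesian_product G H) ^^ k"
  shows "\<exists>j. (u, v) \<in> arcs_ends G ^^ j \<and> j + of_bool (x \<noteq> y) \<le> k"
  using assms
proof (induction k arbitrary: v y)
  case (Suc k)
  then obtain w z where wz: "((u, x), (w, z)) \<in> arcs_ends (cartesian_product G H) ^^ k"
    and step: "(w, z) \<rightarrow>\<^bsub>cartesian_product G H\<^esub> (v, y)" by auto
  from Suc.IH[OF wz] obtain j where j: "(u, w) \<in> arcs_ends G ^^ j" "j + of_bool (x \<noteq> z) \<le> k" by blast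
  from step consider "w = v" | "z = y" "w \<rightarrow>\<^bsub>G\<^esub> v"
    by (auto simp: cartesian_product_dominates)
  then show ?case
  proof cases
    case 1
    then show ?thesis using j by (intro exI[of _ j]) (auto split: if_splits)
  next
    case 2
    then show ?thesis using j by (intro exI[of _ "Suc j"]) auto
  qed
qed simp

lemma connected_cartesian_product_complete:
  assumes G: "graph G" and conn: "Digraph_Component.connected G"
    and "complete_digraph m K" and m: "0 < m"
  shows "Digraph_Component.connected (cartesian_product G K)"
proof -
  have gK: "graph K" and K: "arcs_ends K = {(x, y). (x, y) \<in> verts K \<times> verts K \<and> x \<noteq> y}"
    and K0: "verts K \<noteq> {}"
    using assms by (auto simp: complete_digraph_def)
  interpret G: graph G by (rule G)
  interpret P: graph "cartesian_product G K" by (rule graph_cartesian_product[OF G gK])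
  have sc: "strongly_connected G"
    using conn by (rule G.symmetric_connected_imp_strongly_connected[OF G.sym_arcs])
  have r: "(u, x) \<rightarrow>\<^sup>*\<^bsub>cartesian_product G K\<^esub> (v, y)"
    if "u \<in> verts G" "v \<in> verts G" "x \<in> verts K" "y \<in> verts K" for u v x y
  proof -
    have "(u, v) \<in> (arcs_ends G)\<^sup>*"
      using sc that by (auto simp: strongly_connected_def intro: reachable_rtranclI)
    then obtain j where "(u, v) \<in> arcs_ends G ^^ j" by (auto simp: rtrancl_power)
    from G.relpow_cartesian_product_lift[OF this that(1,3)]
    have "(u, x) \<rightarrow>\<^sup>*\<^bsub>cartesian_product G K\<^esub> (v, x)"
      using that by (simp add: P.reachable_conv relpow_imp_rtrancl)
    also have "(v, x) \<rightarrow>\<^sup>*\<^bsub>cartesian_product G K\<^esub> (v, y)"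
      using that by (cases "x = y") (auto simp: cartesian_product_dominates K)
    finally show ?thesis .
  qed
  show ?thesis
    using sc K0 r
    by (intro P.connectedI) (auto simp: strongly_connected_def P.reachable_mk_symmetric_eq[OF P.sym_arcs])
qed

text \<open>
  In \<open>G \<box> K\<^sub>m\<close> the distance is \<open>d(u, v) + [x \<noteq> y]\<close>: a shortest walk of \<^term>\<open>G\<close> can be copied into
  one layer, and one further step reaches any other layer.  It is put as a condition for one
  value, the form in which distance matrices ask for it; the guard \<^term>\<open>i \<noteq> 0\<close> excludes the
  truncated \<open>0 - 1 = 0\<close>.
\<close>

lemma graph_dist_cartesian_product_complete:
  assumes G: "graph G" and KK: "complete_digraph m K"
    and uv: "u \<in> verts G" "v \<in> verts G" "x \<in> verts K" "y \<in> verts K"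
  shows "graph_dist (cartesian_product G K) (u, x) (v, y) = ereal (real i) \<longleftrightarrow>
    (if x = y then graph_dist G u v = ereal (real i)
     else i \<noteq> 0 \<and> graph_dist G u v = ereal (real (i - 1)))"
proof -
  have gK: "graph K" and K: "arcs_ends K = {(x, y). (x, y) \<in> verts K \<times> verts K \<and> x \<noteq> y}"
    using KK by (auto simp: complete_digraph_def)
  interpret G: graph G by (rule G)
  interpret P: graph "cartesian_product G K" by (rule graph_cartesian_product[OF G gK])
  let ?P = "arcs_ends (cartesian_product G K)"
  have lift: "((u, x), (v, y)) \<in> ?P ^^ (j + of_bool (x \<noteq> y))" if "(u, v) \<in> arcs_ends G ^^ j" for j
  proof -
    have "((u, x), (v, x)) \<in> ?P ^^ j" by (rule G.relpow_cartesian_product_lift[OF that uv(1,3)])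
    then show ?thesis using uv by (cases "x = y") (auto simp: cartesian_product_dominates K)
  qed
  have "graph_dist (cartesian_product G K) (u, x) (v, y) = ereal (real i) \<longleftrightarrow>
     (\<exists>j. i = j + of_bool (x \<noteq> y) \<and> graph_dist G u v = ereal (real j))" (is "?L \<longleftrightarrow> ?R")
  proof
    assume ?L
    then have i: "((u, x), (v, y)) \<in> ?P ^^ i" "\<And>k. k < i \<Longrightarrow> ((u, x), (v, y)) \<notin> ?P ^^ k"
      using uv by (auto simp: P.graph_dist_eq_iff)
    from relpow_cartesian_product_project[OF i(1)] obtain j where
      j: "(u, v) \<in> arcs_ends G ^^ j" "j + of_bool (x \<noteq> y) \<le> i" by blast
    have ij: "i = j + of_bool (x \<noteq> y)" using lift[OF j(1)] i(2) j(2) by (metis le_neq_implies_less)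
    have "(u, v) \<notin> arcs_ends G ^^ k" if "k < j" for k
      using lift[of k] i(2)[of "k + of_bool (x \<noteq> y)"] that ij by auto
    then show ?R using ij j uv by (auto simp: G.graph_dist_eq_iff)
  next
    assume ?R
    then obtain j where ij: "i = j + of_bool (x \<noteq> y)" and j: "(u, v) \<in> arcs_ends G ^^ j"
      "\<And>k. k < j \<Longrightarrow> (u, v) \<notin> arcs_ends G ^^ k" using uv by (auto simp: G.graph_dist_eq_iff)
    have "((u, x), (v, y)) \<notin> ?P ^^ k" if "k < i" for k
    proof
      assume "((u, x), (v, y)) \<in> ?P ^^ k"
      from relpow_cartesian_product_project[OF this] obtain l where "(u, v) \<in> arcs_ends G ^^ l" "l + of_bool (x \<noteq> y) \<le> k" by blast
      with j(2)[of l] that ij show False by (auto split: if_splits)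
    qed
    then show ?L using lift[OF j(1)] uv unfolding ij[symmetric] by (subst P.graph_dist_eq_iff) auto
  qed
  then show ?thesis by (auto simp: gr0_conv_Suc)
qed

section \<open>Kronecker products with the identity and the all-ones matrix\<close>

text \<open>
  The matrix \<open>M \<otimes> I + M' \<otimes> J\<close>, where \<open>J\<close> is the all-ones matrix.  A listing of the product graph
  need not be lexicographic, so row \<open>r\<close> is labelled by the pair \<open>(g r, h r)\<close> instead of being split
  by division with remainder.
\<close>

definition kron_IJ ::
  "nat \<Rightarrow> (nat \<Rightarrow> nat) \<Rightarrow> (nat \<Rightarrow> 'c) \<Rightarrow> 'a :: comm_ring_1 mat \<Rightarrow> 'a mat \<Rightarrow> 'a mat" where
  "kron_IJ N g h M M' =
    mat N N (\<lambda>(r, c). of_bool (h r = h c) * M $$ (g r, g c) + M' $$ (g r, g c))"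

lemma dim_kron_IJ [simp]:
  "dim_row (kron_IJ N g h M M') = N" "dim_col (kron_IJ N g h M M') = N"
  "kron_IJ N g h M M' \<in> carrier_mat N N"
  by (simp_all add: kron_IJ_def)

lemma kron_IJ_index [simp]:
  "r < N \<Longrightarrow> c < N \<Longrightarrow> kron_IJ N g h M M' $$ (r, c) =
    of_bool (h r = h c) * M $$ (g r, g c) + M' $$ (g r, g c)"
  by (simp add: kron_IJ_def)

text \<open>
  The rules \<open>I I = I\<close>, \<open>I J = J I = J\<close> and \<open>J J = |W| J\<close> in one sum, read off at the entry \<open>(a, b)\<close>.
\<close>

lemma sum_of_bool_product:
  fixes p p' q q' :: "'a :: comm_ring_1"
  assumes "finite W" "a \<in> W" "b \<in> W"
  shows "(\<Sum>z\<in>W. (of_bool (a = z) * p + p') * (of_bool (z = b) * q + q')) =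
    of_bool (a = b) * (p * q) + (p * q' + p' * q + of_nat (card W) * (p' * q'))"
proof -
  have "(\<Sum>z\<in>W. (of_bool (a = z) * p + p') * (of_bool (z = b) * q + q')) =
      (\<Sum>z\<in>W. (if z = a then of_bool (a = b) * (p * q) + p * q' else 0) +
        (if z = b then p' * q else 0) + p' * q')"
    by (intro sum.cong refl) (auto simp: algebra_simps)
  then show ?thesis
    using assms by (simp add: sum.distrib add.assoc)
qed

context
  fixes N n m :: nat and g :: "nat \<Rightarrow> nat" and h :: "nat \<Rightarrow> 'c" and W :: "'c set"
  assumes W: "finite W" "card W = m"
    and bij: "bij_betw (\<lambda>k. (g k, h k)) {..<N} ({..<n} \<times> W)"
begin

lemma label_range:
  assumes "k < N"
  shows "g k < n" "h k \<in> W"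
  using bij_betwE[OF bij] assms by auto

lemma label_eq_iff:
  assumes "r < N" "c < N"
  shows "r = c \<longleftrightarrow> g r = g c \<and> h r = h c"
  using bij_betw_imp_inj_on[OF bij] assms by (auto dest: inj_onD)

lemma kron_IJ_mult:
  fixes M M' L L' :: "'a :: comm_ring_1 mat"
  assumes [simp]: "M \<in> carrier_mat n n" "M' \<in> carrier_mat n n" "L \<in> carrier_mat n n" "L' \<in> carrier_mat n n"
  shows "kron_IJ N g h M M' * kron_IJ N g h L L' =
    kron_IJ N g h (M * L) (M * L' + M' * L + of_nat m \<cdot>\<^sub>m (M' * L'))" (is "?X * ?Y = ?Z")
proof (rule eq_matI)
  fix r c assume "r < dim_row ?Z" "c < dim_col ?Z"
  then have rc: "r < N" "c < N" by auto
  note [simp] = rc label_range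
  let ?F = "\<lambda>j z. (of_bool (h r = z) * M $$ (g r, j) + M' $$ (g r, j)) *
        (of_bool (z = h c) * L $$ (j, g c) + L' $$ (j, g c))"
  have dims [simp]: "dim_row M = n" "dim_col M = n" "dim_row M' = n" "dim_col M' = n"
    "dim_row L = n" "dim_col L = n" "dim_row L' = n" "dim_col L' = n"
    using assms by (auto simp only: carrier_mat_def mem_Collect_eq)
  have prod: "(P * Q) $$ (g r, g c) = (\<Sum>j<n. P $$ (g r, j) * Q $$ (j, g c))"
    if "dim_row P = n" "dim_col P = n" "dim_row Q = n" "dim_col Q = n" for P Q :: "'a mat"
    using that by (simp add: scalar_prod_def atLeast0LessThan)
  have "(?X * ?Y) $$ (r, c) = (\<Sum>k<N. case (g k, h k) of (j, z) \<Rightarrow> ?F j z)"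
    by (simp add: scalar_prod_def atLeast0LessThan)
  also have "\<dots> = (\<Sum>(j, z)\<in>{..<n} \<times> W. ?F j z)"
    by (rule sum.reindex_bij_betw[OF bij])
  also have "\<dots> = (\<Sum>j<n. \<Sum>z\<in>W. ?F j z)"
    by (rule sum.cartesian_product[symmetric])
  also have "\<dots> = (\<Sum>j<n. of_bool (h r = h c) * (M $$ (g r, j) * L $$ (j, g c)) +
      (M $$ (g r, j) * L' $$ (j, g c) + M' $$ (g r, j) * L $$ (j, g c) +
        of_nat m * (M' $$ (g r, j) * L' $$ (j, g c))))"
    by (simp add: sum_of_bool_product[OF W(1)] W(2))
  also have "\<dots> = ?Z $$ (r, c)"
    by (simp add: prod sum.distrib sum_distrib_left del: index_mult_mat(1))
  finally show "(?X * ?Y) $$ (r, c) = ?Z $$ (r, c)" .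
qed auto

text \<open>
  On the range of \<open>I \<otimes> J\<close>, which acts there as \<open>m\<close>, the matrix \<open>B \<otimes> I + I \<otimes> J\<close> acts as
  \<open>B + m I\<close>, and on the complementary kernel as \<open>B\<close>.  The projection onto the range is \<open>I \<otimes> J / m\<close>, which gives the
  coefficient of \<open>J\<close>.
\<close>

lemma poly_mat_kron_IJ:
  fixes B :: "'a :: field mat"
  assumes B: "B \<in> carrier_mat n n" and m: "of_nat m \<noteq> (0 :: 'a)"
  shows "poly_mat f (kron_IJ N g h B (1\<^sub>m n)) =
    kron_IJ N g h (poly_mat f B)
      (inverse (of_nat m) \<cdot>\<^sub>m (poly_mat f (B + of_nat m \<cdot>\<^sub>m 1\<^sub>m n) - poly_mat f B))"
proof (induction f)
  case 0
  then show ?case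
    using B by (intro eq_matI) (auto simp: label_range)
next
  case (pCons a f)
  define S where "S = B + of_nat m \<cdot>\<^sub>m 1\<^sub>m n"
  define P where "P = poly_mat f B"
  define Q where "Q = poly_mat f S"
  define H where "H = inverse (of_nat m) \<cdot>\<^sub>m (Q - P)"
  have S: "S \<in> carrier_mat n n" using B by (simp add: S_def)
  have c: "P \<in> carrier_mat n n" "Q \<in> carrier_mat n n" "H \<in> carrier_mat n n"
    using B S by (auto simp: P_def Q_def H_def)
  have HB: "H * B = inverse (of_nat m) \<cdot>\<^sub>m (Q * B - P * B)"
    unfolding H_def using minus_mult_distrib_mat[OF c(2,1) B]
      mult_smult_assoc_mat[OF minus_carrier_mat[OF c(1)] B] by simp
  have QS: "Q * S = Q * B + of_nat m \<cdot>\<^sub>m Q"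
    unfolding S_def using mult_add_distrib_mat[OF c(2) B, of "of_nat m \<cdot>\<^sub>m 1\<^sub>m n"]
      mult_smult_distrib[OF c(2) one_carrier_mat, of "of_nat m"] right_mult_one_mat[OF c(2)] by simp
  have "poly_mat (pCons a f) (kron_IJ N g h B (1\<^sub>m n)) =
      a \<cdot>\<^sub>m 1\<^sub>m N + kron_IJ N g h P H * kron_IJ N g h B (1\<^sub>m n)"
    by (simp add: poly_mat_pCons[of _ N] pCons P_def Q_def H_def S_def)
  also have "kron_IJ N g h P H * kron_IJ N g h B (1\<^sub>m n) =
      kron_IJ N g h (P * B) (P + H * B + of_nat m \<cdot>\<^sub>m H)"
    using c B by (simp add: kron_IJ_mult)
  also have "a \<cdot>\<^sub>m 1\<^sub>m N + \<dots> = kron_IJ N g h (a \<cdot>\<^sub>m 1\<^sub>m n + P * B)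
      (inverse (of_nat m) \<cdot>\<^sub>m ((a \<cdot>\<^sub>m 1\<^sub>m n + Q * S) - (a \<cdot>\<^sub>m 1\<^sub>m n + P * B)))"
    unfolding HB QS unfolding H_def
  proof (rule eq_matI, goal_cases)
    case (1 r c)
    then have rc: "r < N" "c < N" by auto
    have d: "dim_row P = n" "dim_col P = n" "dim_row Q = n" "dim_col Q = n" "dim_row B = n" "dim_col B = n"
      using c B by auto
    show ?case
      using rc m label_range[OF rc(1)] label_range[OF rc(2)]
      by (auto simp: d label_eq_iff[OF rc] field_simps simp del: index_mult_mat(1))
  qed auto
  finally show ?case
    by (simp add: poly_mat_pCons[OF B] poly_mat_pCons[OF S] P_def Q_def S_def[symmetric])
qed

text \<open>
  When \<open>P\<close> is the characteristic polynomial of \<open>A\<close>, the coprimality hypothesis says that \<open>A\<close> and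
  \<open>A + m I\<close> have no common eigenvalue over an algebraic closure.  Then the values
  of a polynomial at \<open>A\<close> and at \<open>A + m I\<close> can be prescribed independently among polynomials in
  \<open>A\<close>, by the Chinese remainder theorem modulo \<open>P(X)\<close> and \<open>P(X - m)\<close>.  The values needed are
  \<open>q(A)\<close> and \<open>q(A) + m r(A)\<close>.
\<close>

lemma kron_IJ_in_polynomials:
  fixes A :: "'a :: field_gcd mat"
  assumes A: "A \<in> carrier_mat n n" and m: "of_nat m \<noteq> (0 :: 'a)"
    and P: "poly_mat P A = 0\<^sub>m n n"
    and coprime: "coprime P (pcompose P [:- of_nat m, 1:])"
  shows "\<exists>f. poly_mat f (kron_IJ N g h A (1\<^sub>m n)) = kron_IJ N g h (poly_mat q A) (poly_mat r A)"
proof -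
  define P' where "P' = pcompose P [:- of_nat m, 1:]"
  define S where "S = A + of_nat m \<cdot>\<^sub>m 1\<^sub>m n"
  have S: "S \<in> carrier_mat n n" using A by (simp add: S_def)
  have shift: "poly_mat [:- of_nat m, 1:] S = A"
    using A by (intro eq_matI) (auto simp: poly_mat_pCons[of _ n] poly_mat_const[of _ n] S_def)
  have eval_shift: "poly_mat (pcompose p [:- of_nat m, 1:]) S = poly_mat p A" for p
    by (simp add: poly_mat_pcompose[OF S] shift)
  obtain u v where uv: "u * P + v * P' = 1"
    using coprime bezout_coefficients_fst_snd[of P P'] by (auto simp: P'_def)
  \<comment> \<open>The Chinese remainder solution of \<open>f \<equiv> q\<close> modulo \<open>P\<close> and \<open>f \<equiv> b\<close> modulo \<open>P'\<close>.\<close>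
  define b where "b = pcompose (q + Polynomial.smult (of_nat m) r) [:- of_nat m, 1:]"
  define f where "f = q * (v * P') + b * (u * P)"
  have "v * P' = 1 - u * P" "u * P = 1 - v * P'"
    using uv by (simp_all add: algebra_simps)
  then have f1: "f = q + (b - q) * u * P" and f2: "f = b + (q - b) * v * P'"
    unfolding f_def by (simp_all add: mult.assoc) (simp_all add: algebra_simps)
  have fA: "poly_mat f A = poly_mat q A"
    unfolding f1 using A by (simp add: poly_mat_add[OF A] poly_mat_mult[OF A] P)
  have fS: "poly_mat f S = poly_mat q A + of_nat m \<cdot>\<^sub>m poly_mat r A"
    unfolding f2 using A S by (simp add: poly_mat_add[OF S] poly_mat_mult[OF S] P'_def b_def eval_shift P
        poly_mat_add[OF A] poly_mat_smult[OF A])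
  have "poly_mat f (kron_IJ N g h A (1\<^sub>m n)) = kron_IJ N g h (poly_mat q A)
      (inverse (of_nat m) \<cdot>\<^sub>m ((poly_mat q A + of_nat m \<cdot>\<^sub>m poly_mat r A) - poly_mat q A))"
    unfolding poly_mat_kron_IJ[OF A m] S_def[symmetric] fA fS ..
  also have "\<dots> = kron_IJ N g h (poly_mat q A) (poly_mat r A)"
    using A m by (intro eq_matI) (auto simp: label_range)
  finally show ?thesis by blast
qed

end

text \<open>
  The substitution moves the roots \<open>a\<^sub>i\<close> to \<open>a\<^sub>i + s\<close>, so the hypothesis says that no root is shared.
\<close>

lemma coprime_linear_products:
  fixes a :: "nat \<Rightarrow> 'a :: field_gcd"
  assumes "\<And>i j. i \<in> I \<Longrightarrow> j \<in> I \<Longrightarrow> a i - a j \<noteq> s"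
  shows "coprime (\<Prod>i\<in>I. [:- a i, 1:]) (pcompose (\<Prod>i\<in>I. [:- a i, 1:]) [:- s, 1:])"
proof -
  have "coprime [:- a i, 1:] [:- a j - s, 1:]" if ij: "i \<in> I" "j \<in> I" for i j
  proof -
    define d where "d = s + a j - a i"
    have "d \<noteq> 0" using assms[OF ij] by (auto simp: d_def algebra_simps)
    moreover have "[:e:] * [:- a i, 1:] - [:e:] * [:- a j - s, 1:] = [:e * d:]" for e
      by (simp add: d_def algebra_simps)
    ultimately have "1 = [:inverse d:] * [:- a i, 1:] - [:inverse d:] * [:- a j - s, 1:]"
      by (simp add: one_pCons)
    then show ?thesis by (metis coprimeI dvd_diff dvd_mult)
  qed
  then show ?thesis
    by (auto simp: pcompose_prod pcompose_pCons intro!: prod_coprime_left prod_coprime_right)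
qed

section \<open>Distance-polynomial products\<close>

text \<open>
  Outside the range between \<open>1\<close> and the diameter the distance matrix is \<open>I\<close> (for \<open>i = 0\<close>) or \<open>0\<close>
  (for \<open>i\<close> above the diameter).  Both cases are needed: the product's distance matrices involve
  index \<open>i - 1 = 0\<close>, and the product can have a larger diameter than \<^term>\<open>G\<close>.
\<close>

lemma dp_graph_dist_mat:
  assumes "dp_graph G" "vertex_listing G vs"
  shows "\<exists>p. dist_mat G vs i = poly_mat p (adjacency_mat G vs)"
proof -
  interpret graph G using assms by (simp add: dp_graph_def)
  have A: "adjacency_mat G vs \<in> carrier_mat (length vs) (length vs)"
    by (simp add: adjacency_mat_def)
  have vs: "distinct vs" "set vs = verts G" using assms by (auto simp: vertex_listing_def)
  consider "i = 0" | "1 \<le> i" "ereal (real i) \<le> graph_diameter G" | "\<not> ereal (real i) \<le> graph_diameter G"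
    by linarith
  then show ?thesis
  proof cases
    case 1
    have "graph_dist G (vs ! k) v = ereal 0 \<longleftrightarrow> vs ! k = v" if "k < length vs" for k v
      using graph_dist_eq_iff[of "vs ! k" v 0] nth_mem[OF that] vs(2) by simp
    then have "dist_mat G vs 0 = 1\<^sub>m (length vs)"
      using vs by (intro eq_matI) (auto simp: dist_mat_def nth_eq_iff_index_eq)
    then show ?thesis using 1 poly_mat_1[OF A] by metis
  next
    case 2
    then show ?thesis using assms by (auto simp: dp_graph_def)
  next
    case 3
    have "graph_dist G u v \<noteq> ereal (real i)" if "u \<in> verts G" "v \<in> verts G" for u v
    proof -
      have "graph_dist G u v \<le> graph_diameter G"
        unfolding graph_diameter_def using that by (intro SUP_upper2[of u] SUP_upper) auto
      then show ?thesis using 3 by auto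
    qed
    then have "dist_mat G vs i = 0\<^sub>m (length vs) (length vs)"
      unfolding dist_mat_def vs(2)[symmetric] by (intro eq_matI) auto
    then show ?thesis using A by (intro exI[of _ 0]) simp
  qed
qed

theorem corollary4p10:
  fixes G :: "('a, 'b) pre_digraph" and K :: "('c, 'd) pre_digraph"
    and vs :: "'a list" and ev :: "nat \<Rightarrow> real" and n m :: nat
  assumes "dp_graph G"
    and "vertex_listing G vs"
    and "n = card (verts G)"
    and "char_poly (adjacency_mat G vs) = (\<Prod>i = 1..n. [:- ev i, 1:])"
    and "\<And>i j. 1 \<le> i \<Longrightarrow> i \<le> j \<Longrightarrow> j \<le> n \<Longrightarrow> ev i \<ge> ev j"
    and "real m > ev 1 - ev n"
    and "complete_digraph m K"
  shows "dp_graph (cartesian_product G K)"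
proof -
  have G: "graph G" and conn: "Digraph_Component.connected G"
    using assms(1) by (auto simp: dp_graph_def)
  have gK: "graph K" and cardK: "card (verts K) = m"
    and K: "arcs_ends K = {(x, y). (x, y) \<in> verts K \<times> verts K \<and> x \<noteq> y}"
    using assms(7) by (auto simp: complete_digraph_def)
  interpret G: graph G by fact
  interpret K: graph K by fact
  let ?P = "cartesian_product G K"
  let ?A = "adjacency_mat G vs"
  have gP: "graph ?P" by (rule graph_cartesian_product[OF G gK])
  have vs: "distinct vs" "set vs = verts G" "length vs = n"
    using assms(2,3) distinct_card[of vs] by (auto simp: vertex_listing_def)
  have "verts G \<noteq> {}" using conn by (auto simp: connected_conv)
  then have "1 \<le> n" using assms(3) by (simp add: Suc_le_eq card_gt_0_iff)
  then have m: "0 < m" using assms(5)[of 1 n] assms(6) by (cases m) auto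
  have A: "?A \<in> carrier_mat n n" using vs by (simp add: adjacency_mat_def)
  have coprime: "coprime (char_poly ?A) (pcompose (char_poly ?A) [:- of_nat m, 1:])"
    unfolding assms(4)
  proof (rule coprime_linear_products)
    fix i j assume "i \<in> {1..n}" "j \<in> {1..n}"
    then have "ev i \<le> ev 1" "ev n \<le> ev j" using assms(5) by auto
    then show "ev i - ev j \<noteq> of_nat m" using assms(6) by simp
  qed
  show ?thesis
    unfolding dp_graph_def
  proof (intro conjI allI impI)
    show "graph ?P" by (rule gP)
    show "Digraph_Component.connected ?P" by (rule connected_cartesian_product_complete[OF G conn assms(7) m])
    fix ws i assume ws: "vertex_listing ?P ws" and i: "1 \<le> i \<and> ereal (real i) \<le> graph_diameter ?P"
    define N where "N = length ws"
    have ws: "distinct ws" "set ws = verts G \<times> verts K" using ws by (auto simp: vertex_listing_def)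
    define h where "h k = snd (ws ! k)" for k
    have "\<exists>j<n. vs ! j = fst (ws ! k)" if "k < N" for k
      using that ws(2) vs nth_mem[of k ws] unfolding N_def in_set_conv_nth[symmetric]
      by (metis in_set_conv_nth mem_Times_iff)
    then obtain g where g: "\<And>k. k < N \<Longrightarrow> g k < n" "\<And>k. k < N \<Longrightarrow> vs ! g k = fst (ws ! k)"
      by metis
    have wsk: "ws ! k = (vs ! g k, h k)" "vs ! g k \<in> verts G" "h k \<in> verts K" if "k < N" for k
      using that g ws(2) nth_mem[of k ws] by (auto simp: h_def N_def)
    have bij: "bij_betw (\<lambda>k. (g k, h k)) {..<N} ({..<n} \<times> verts K)"
      unfolding bij_betw_def
    proof
      show "inj_on (\<lambda>k. (g k, h k)) {..<N}"
        using wsk(1) ws(1) by (intro inj_onI) (metis N_def lessThan_iff nth_eq_iff_index_eq Pair_inject)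
      show "(\<lambda>k. (g k, h k)) ` {..<N} = {..<n} \<times> verts K"
      proof (intro equalityI subsetI)
        fix jx assume "jx \<in> {..<n} \<times> verts K"
        then obtain j x where jx: "jx = (j, x)" "j < n" "x \<in> verts K" by auto
        then have "(vs ! j, x) \<in> set ws" using ws(2) vs by auto
        then obtain k where k: "k < N" "ws ! k = (vs ! j, x)" by (auto simp: in_set_conv_nth N_def)
        then have "vs ! g k = vs ! j" "h k = x" using wsk(1)[of k] by auto
        then show "jx \<in> (\<lambda>k. (g k, h k)) ` {..<N}"
          using jx k(1) g(1) vs by (auto simp: nth_eq_iff_index_eq intro!: image_eqI[of _ _ k])
      qed (use g wsk in auto)
    qed
    note lab = label_range[OF K.finite_verts cardK bij] label_eq_iff[OF K.finite_verts cardK bij]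
    \<comment> \<open>\<open>K\<^sub>m\<close> contributes \<open>I \<otimes> (J - I)\<close>; adding the identity leaves \<open>A \<otimes> I + I \<otimes> J\<close>.\<close>
    have adj: "kron_IJ N g h ?A (1\<^sub>m n) = adjacency_mat ?P ws + 1\<^sub>m N"
    proof (rule eq_matI, goal_cases)
      case (1 r c)
      then have rc: "r < N" "c < N" by (auto simp: adjacency_mat_def N_def)
      show ?case
        using rc g wsk(2,3)[OF rc(1)] wsk(2,3)[OF rc(2)] vs G.adj_not_same
        by (auto simp: adjacency_mat_def N_def[symmetric] wsk(1) lab(3) cartesian_product_dominates K
            nth_eq_iff_index_eq)
    qed (auto simp: adjacency_mat_def N_def)
    obtain q where q: "dist_mat G vs i = poly_mat q ?A"
      using dp_graph_dist_mat[OF assms(1,2)] by blast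
    obtain r where r: "dist_mat G vs (i - 1) = poly_mat r ?A"
      using dp_graph_dist_mat[OF assms(1,2)] by blast
    \<comment> \<open>This is \<open>A\<^sub>i \<otimes> I + A\<^bsub>i-1\<^esub> \<otimes> (J - I)\<close>, regrouped.\<close>
    have "dist_mat ?P ws i = kron_IJ N g h (dist_mat G vs i - dist_mat G vs (i - 1)) (dist_mat G vs (i - 1))"
    proof (rule eq_matI, goal_cases)
      case (1 r c)
      then have rc: "r < N" "c < N" by auto
      show ?case
        using rc g wsk(2,3)[OF rc(1)] wsk(2,3)[OF rc(2)] vs i
        by (auto simp: dist_mat_def N_def[symmetric] wsk(1) graph_dist_cartesian_product_complete[OF G assms(7)])
    qed (auto simp: dist_mat_def N_def)
    also have "\<dots> = kron_IJ N g h (poly_mat (q - r) ?A) (poly_mat r ?A)"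
      by (simp only: q r poly_mat_diff[OF A])
    finally obtain f where "poly_mat f (kron_IJ N g h ?A (1\<^sub>m n)) = dist_mat ?P ws i"
      using kron_IJ_in_polynomials[OF K.finite_verts cardK bij A _ cayley_hamilton[OF A] coprime, of "q - r" r] m
      by auto
    moreover have "poly_mat f (kron_IJ N g h ?A (1\<^sub>m n)) = poly_mat (pcompose f [:1, 1:]) (adjacency_mat ?P ws)"
    proof -
      have P: "adjacency_mat ?P ws \<in> carrier_mat N N" by (simp add: adjacency_mat_def N_def)
      have "poly_mat [:1, 1:] (adjacency_mat ?P ws) = adjacency_mat ?P ws + 1\<^sub>m N"
        using P by (intro eq_matI) (auto simp: poly_mat_pCons[OF P] poly_mat_const[OF P])
      then show ?thesis by (simp add: poly_mat_pcompose[OF P] adj)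
    qed
    ultimately show "\<exists>p. dist_mat ?P ws i = poly_mat p (adjacency_mat ?P ws)" by metis
  qed
qed

end
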